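(* For every $n\geq 1$, let $M(n)$ be the number of (distinct, not necessarily inequivalent) self-dual $L$-codes of length $n$. Then $$M(n)=\sum_{[C]}\frac{2^n\cdot n!}{|\mathrm{Aut}(C)|}=\prod_{i=1}^n(2^i+1),$$ where the sum runs over the equivalence classes $[C]$ of self-dual $L$-codes of length $n$.
   Context: Let $L=\{0,1,\omega,\bar\omega\}$ be the Klein four-group $\mathbf{Z}_2\times\mathbf{Z}_2$ (so $1+\omega=\bar\omega$, etc.). Define $|0|^2=0$, $|1|^2=1$, $|\omega|^2=|\bar\omega|^2=2$ and $q(x)=|x|^2 \bmod 2$. The dot product on $L$ is $x\cdot y=q(x+y)-q(x)-q(y)\in\mathbf{F}_2$; explicitly $x\cdot y=1$ iff $x,y$ are distinct and both nonzero. On $L^n$ the scalar product is $(\mathbf{x},\mathbf{y})=\sum_i x_i\cdot y_i\in\mathbf{F}_2$. An $L$-code of length $n$ is a subgroup $C\subseteq L^n$. Its dual is $C^\perp=\{\mathbf{x}\in L^n:(\mathbf{x},\mathbf{y})=0\ \forall \mathbf{y}\in C\}$; $C$ is self-dual if $C=C^\perp$. The group $G=S_2^n{:}S_n$ (order $2^n n!$) acts on $L^n$ by permuting the coordinates and independently interchanging $\omega$ and $\bar\omega$ in each coordinate; two codes are equivalent if they lie in the same $G$-orbit, and $\mathrm{Aut}(C)=\{g\in G: gC=C\}$. *)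

theory Defs
  imports
    Complex_Main
    "HOL-Algebra.Sym_Groups"
    "HOL-Algebra.Product_Groups"
    "HOL-Algebra.Group_Action"
    "HOL-Library.Z2"
begin

text \<open>The elements \<open>0\<close>, \<open>1\<close>, \<open>\<omega>\<close>, \<open>\<omega>\<close>-bar of the Klein four-group:\<close>

datatype klein = K0 | K1 | Kw | Kwbar

fun klein_add :: "klein \<Rightarrow> klein \<Rightarrow> klein" where
  "klein_add K0 y = y"
| "klein_add x K0 = x"
| "klein_add K1 Kw = Kwbar"
| "klein_add Kw K1 = Kwbar"
| "klein_add K1 Kwbar = Kw"
| "klein_add Kwbar K1 = Kw"
| "klein_add Kw Kwbar = K1"
| "klein_add Kwbar Kw = K1"
| "klein_add K1 K1 = K0"
| "klein_add Kw Kw = K0"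
| "klein_add Kwbar Kwbar = K0"

definition klein_group :: "klein monoid"
  where "klein_group = \<lparr>carrier = UNIV, mult = klein_add, one = K0\<rparr>"

lemma klein_add_self: "klein_add x x = K0"
  by (cases x) simp_all

lemma klein_add_assoc: "klein_add (klein_add x y) z = klein_add x (klein_add y z)"
  by (cases x; cases y; cases z) simp_all

lemma group_klein_group: "group klein_group"
  by (rule groupI) (auto simp: klein_group_def klein_add_assoc intro: klein_add_self)

text \<open>The norm \<open>|x|\<^sup>2\<close>, the quadratic form \<open>q\<close> and its polarization. The field of two
  elements is the type \<^typ>\<open>bit\<close>, in which \<^const>\<open>of_nat\<close> is reduction mod 2.\<close>

fun norm2 :: "klein \<Rightarrow> nat" where
  "norm2 K0 = 0"
| "norm2 K1 = 1"
| "norm2 Kw = 2"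
| "norm2 Kwbar = 2"

definition q :: "klein \<Rightarrow> bit"
  where "q x = of_nat (norm2 x)"

definition dot :: "klein \<Rightarrow> klein \<Rightarrow> bit"
  where "dot x y = q (x \<otimes>\<^bsub>klein_group\<^esub> y) - q x - q y"

lemma dot_eq_1_iff: "dot x y = 1 \<longleftrightarrow> x \<noteq> y \<and> x \<noteq> K0 \<and> y \<noteq> K0"
  by (cases x; cases y) (simp_all add: dot_def q_def klein_group_def)

text \<open>\<open>L\<^sup>n\<close> consists of the functions from \<open>{1..n}\<close> to \<open>L\<close> that are extensional, i.e.\ take
  the value \<^const>\<open>undefined\<close> outside \<open>{1..n}\<close>.\<close>

definition Ln :: "nat \<Rightarrow> (nat \<Rightarrow> klein) monoid"
  where "Ln n = product_group {1..n} (\<lambda>_. klein_group)"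

definition scalar_prod :: "nat \<Rightarrow> (nat \<Rightarrow> klein) \<Rightarrow> (nat \<Rightarrow> klein) \<Rightarrow> bit"
  where "scalar_prod n x y = (\<Sum>i=1..n. dot (x i) (y i))"

definition L_code :: "nat \<Rightarrow> (nat \<Rightarrow> klein) set \<Rightarrow> bool"
  where "L_code n C \<longleftrightarrow> subgroup C (Ln n)"

definition dual_code :: "nat \<Rightarrow> (nat \<Rightarrow> klein) set \<Rightarrow> (nat \<Rightarrow> klein) set"
  where "dual_code n C = {x \<in> carrier (Ln n). \<forall>y\<in>C. scalar_prod n x y = 0}"

definition self_dual_codes :: "nat \<Rightarrow> (nat \<Rightarrow> klein) set set"
  where "self_dual_codes n = {C. L_code n C \<and> C = dual_code n C}"

text \<open>\<open>S\<^sub>2\<close> acts on \<open>L\<close> by interchanging \<open>\<omega>\<close> and \<open>\<omega>\<close>-bar; the group \<open>S\<^sub>2\<^sup>n:S\<^sub>n\<close> is the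
  semidirect product of pairs \<open>(s, p)\<close>, where \<open>(s, p)\<close> acts on \<open>L\<^sup>n\<close> by first moving the entry
  in position \<open>i\<close> to position \<open>p i\<close> and then applying \<open>s i\<close> to the new \<open>i\<close>-th entry.\<close>

fun klein_swap :: "klein \<Rightarrow> klein" where
  "klein_swap K0 = K0"
| "klein_swap K1 = K1"
| "klein_swap Kw = Kwbar"
| "klein_swap Kwbar = Kw"

definition swap_group :: "(klein \<Rightarrow> klein) monoid"
  where "swap_group = \<lparr>carrier = {id, klein_swap}, mult = (\<circ>), one = id\<rparr>"

definition code_group :: "nat \<Rightarrow> ((nat \<Rightarrow> klein \<Rightarrow> klein) \<times> (nat \<Rightarrow> nat)) monoid"
  where "code_group n =
    \<lparr>carrier = carrier (product_group {1..n} (\<lambda>_. swap_group)) \<times> carrier (sym_group n),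
     mult = (\<lambda>(s, p) (t, r).
       (s \<otimes>\<^bsub>product_group {1..n} (\<lambda>_. swap_group)\<^esub> (\<lambda>i\<in>{1..n}. t (inv' p i)), p \<otimes>\<^bsub>sym_group n\<^esub> r)),
     one = (\<one>\<^bsub>product_group {1..n} (\<lambda>_. swap_group)\<^esub>, \<one>\<^bsub>sym_group n\<^esub>)\<rparr>"

definition vec_act ::
    "nat \<Rightarrow> (nat \<Rightarrow> klein \<Rightarrow> klein) \<times> (nat \<Rightarrow> nat) \<Rightarrow> (nat \<Rightarrow> klein) \<Rightarrow> (nat \<Rightarrow> klein)"
  where "vec_act n = (\<lambda>(s, p) x. \<lambda>i\<in>{1..n}. s i (x (inv' p i)))"

definition code_act ::
    "nat \<Rightarrow> (nat \<Rightarrow> klein \<Rightarrow> klein) \<times> (nat \<Rightarrow> nat) \<Rightarrow> (nat \<Rightarrow> klein) set \<Rightarrow> (nat \<Rightarrow> klein) set"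
  where "code_act n g C = vec_act n g ` C"

definition Aut :: "nat \<Rightarrow> (nat \<Rightarrow> klein) set \<Rightarrow> ((nat \<Rightarrow> klein \<Rightarrow> klein) \<times> (nat \<Rightarrow> nat)) set"
  where "Aut n C = stabilizer (code_group n) (code_act n) C"

definition self_dual_classes :: "nat \<Rightarrow> (nat \<Rightarrow> klein) set set set"
  where "self_dual_classes n = orbits (code_group n) (self_dual_codes n) (code_act n)"

lemma klein_swap_neq_id: "klein_swap \<noteq> id"
  by (metis id_apply klein.distinct(11) klein_swap.simps(3))

lemma klein_swap_swap: "klein_swap \<circ> klein_swap = id"
proof
  fix x show "(klein_swap \<circ> klein_swap) x = id x" by (cases x) simp_all
qed

lemma group_swap_group: "group swap_group"
  by (rule groupI) (auto simp: swap_group_def klein_swap_swap o_assoc)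

lemma order_code_group: "order (code_group n) = 2 ^ n * fact n"
proof -
  have "card {id, klein_swap} = 2"
    using klein_swap_neq_id by (simp add: card_insert_if)
  then show ?thesis
    by (simp add: order_def code_group_def card_cartesian_product card_PiE sym_group_def
        swap_group_def card_permutations[OF refl])
qed

lemma inv_in_range: "p permutes {1..n} \<Longrightarrow> i \<in> {1..n} \<Longrightarrow> inv' p i \<in> {1..n}"
  by (metis permutes_in_image permutes_inv)

lemma group_code_group: "group (code_group n)"
proof (rule groupI)
  fix x y assume "x \<in> carrier (code_group n)" "y \<in> carrier (code_group n)"
  moreover obtain s p t r where "x = (s, p)" "y = (t, r)" by fastforce
  ultimately have s: "s \<in> {1..n} \<rightarrow>\<^sub>E carrier swap_group" and t: "t \<in> {1..n} \<rightarrow>\<^sub>E carrier swap_group"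
    and p: "p permutes {1..n}" and r: "r permutes {1..n}"
    and xy: "x = (s, p)" "y = (t, r)"
    by (auto simp: code_group_def sym_group_def)
  have "s i \<otimes>\<^bsub>swap_group\<^esub> t (inv' p i) \<in> carrier swap_group" if "i \<in> {1..n}" for i
    using s t inv_in_range[OF p that] that group.is_monoid[OF group_swap_group]
    by (intro monoid.m_closed) auto
  then show "x \<otimes>\<^bsub>code_group n\<^esub> y \<in> carrier (code_group n)"
    using p r by (auto simp: xy code_group_def sym_group_def permutes_compose)
next
  show "\<one>\<^bsub>code_group n\<^esub> \<in> carrier (code_group n)"
    by (auto simp: code_group_def sym_group_def permutes_id swap_group_def)
next
  fix x y z
  assume "x \<in> carrier (code_group n)" "y \<in> carrier (code_group n)" "z \<in> carrier (code_group n)"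
  moreover obtain s p t r u v where xyz: "x = (s, p)" "y = (t, r)" "z = (u, v)"
    by (metis prod.exhaust)
  ultimately have p: "p permutes {1..n}" and r: "r permutes {1..n}"
    by (auto simp: code_group_def sym_group_def)
  have "inv' (p \<circ> r) i = inv' r (inv' p i)" for i
    using o_inv_distrib[OF permutes_bij[OF p] permutes_bij[OF r]] by simp
  then show "x \<otimes>\<^bsub>code_group n\<^esub> y \<otimes>\<^bsub>code_group n\<^esub> z = x \<otimes>\<^bsub>code_group n\<^esub> (y \<otimes>\<^bsub>code_group n\<^esub> z)"
    using inv_in_range[OF p] inv_in_range[OF r]
    by (auto simp: xyz code_group_def sym_group_def swap_group_def o_assoc restrict_def fun_eq_iff)
next
  fix x assume "x \<in> carrier (code_group n)"
  moreover obtain s p where "x = (s, p)" by fastforce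
  ultimately have s: "s \<in> {1..n} \<rightarrow>\<^sub>E carrier swap_group" and p: "p permutes {1..n}"
    and x: "x = (s, p)"
    by (auto simp: code_group_def sym_group_def)
  have se: "s \<in> extensional {1..n}" using s by (simp add: PiE_def)
  show "\<one>\<^bsub>code_group n\<^esub> \<otimes>\<^bsub>code_group n\<^esub> x = x"
    using se
    by (auto simp: x code_group_def sym_group_def swap_group_def fun_eq_iff extensional_def)
  let ?t = "\<lambda>i\<in>{1..n}. s (p i)"
  have pin: "p i \<in> {1..n}" if "i \<in> {1..n}" for i
    using permutes_in_image[OF p] that by blast
  have "(?t, inv' p) \<in> carrier (code_group n)"
    using s pin permutes_inv[OF p]
    by (auto simp: code_group_def sym_group_def)
  moreover have "s (p i) \<circ> s (p i) = id" if "i \<in> {1..n}" for i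
    using PiE_mem[OF s pin[OF that]] by (auto simp: swap_group_def klein_swap_swap)
  then have "(?t, inv' p) \<otimes>\<^bsub>code_group n\<^esub> x = \<one>\<^bsub>code_group n\<^esub>"
    using permutes_inv_o(2)[OF p] permutes_inv_inv[OF p]
    by (auto simp: x code_group_def sym_group_def swap_group_def intro!: restrict_ext)
  ultimately show "\<exists>y\<in>carrier (code_group n). y \<otimes>\<^bsub>code_group n\<^esub> x = \<one>\<^bsub>code_group n\<^esub>"
    by blast
qed

lemma vec_act_one: "x \<in> carrier (Ln n) \<Longrightarrow> vec_act n \<one>\<^bsub>code_group n\<^esub> x = x"
  by (auto simp: vec_act_def code_group_def swap_group_def sym_group_def Ln_def PiE_def
      extensional_def fun_eq_iff)

lemma vec_act_mult:
  assumes "g \<in> carrier (code_group n)" "h \<in> carrier (code_group n)"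
  shows "vec_act n (g \<otimes>\<^bsub>code_group n\<^esub> h) x = vec_act n g (vec_act n h x)"
proof -
  obtain s p t r where gh: "g = (s, p)" "h = (t, r)" by fastforce
  with assms have p: "p permutes {1..n}" and r: "r permutes {1..n}"
    by (auto simp: code_group_def sym_group_def)
  have "inv' (p \<circ> r) i = inv' r (inv' p i)" for i
    using o_inv_distrib[OF permutes_bij[OF p] permutes_bij[OF r]] by simp
  then show ?thesis
    using inv_in_range[OF p]
    by (auto simp: gh vec_act_def code_group_def sym_group_def swap_group_def fun_eq_iff)
qed

lemma vec_act_closed: "vec_act n g x \<in> carrier (Ln n)"
  by (auto simp: vec_act_def Ln_def klein_group_def split: prod.split)

end

theory Submission
  imports Defs
begin

section \<open>Lagrangian subgroups of a finite symplectic space over the field of two elements\<close>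

text \<open>An abelian group in which every element squares to one is a vector space over F_2. Its
  subgroups are then its subspaces and a biadditive form is bilinear, so group theory suffices for
  the linear algebra below.\<close>

locale binary_symplectic = comm_group G for G (structure) +
  fixes b :: "'a \<Rightarrow> 'a \<Rightarrow> bit"
  assumes finite_carrier: "finite (carrier G)"
    and square_one: "x \<in> carrier G \<Longrightarrow> x \<otimes> x = \<one>"
    and form_mult: "\<lbrakk>x \<in> carrier G; y \<in> carrier G; z \<in> carrier G\<rbrakk> \<Longrightarrow> b (x \<otimes> y) z = b x z + b y z"
    and form_commute: "\<lbrakk>x \<in> carrier G; y \<in> carrier G\<rbrakk> \<Longrightarrow> b x y = b y x"
    and form_self: "x \<in> carrier G \<Longrightarrow> b x x = 0"
    and nondegenerate: "\<lbrakk>x \<in> carrier G; \<And>y. y \<in> carrier G \<Longrightarrow> b x y = 0\<rbrakk> \<Longrightarrow> x = \<one>"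
begin

section \<open>Orthogonal complements and character sums\<close>

definition perp :: "'a set \<Rightarrow> 'a set"
  where "perp H = {x \<in> carrier G. \<forall>y\<in>H. b x y = 0}"

definition lagrangians :: "'a set set"
  where "lagrangians = {C. subgroup C G \<and> C = perp C}"

text \<open>The nontrivial additive character of F_2, with values in \<open>int\<close> so that
  terms can cancel.\<close>

definition sign :: "bit \<Rightarrow> int"
  where "sign t = (if t = 0 then 1 else - 1)"

lemma sign_add: "sign (s + t) = sign s * sign t"
  by (cases s; cases t) (simp_all add: sign_def)

lemma form_mult_right:
  "\<lbrakk>x \<in> carrier G; y \<in> carrier G; z \<in> carrier G\<rbrakk> \<Longrightarrow> b x (y \<otimes> z) = b x y + b x z"
  by (metis form_commute form_mult m_closed)

lemma form_one_left: "x \<in> carrier G \<Longrightarrow> b \<one> x = 0"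
  using form_mult[of \<one> \<one> x] by (cases "b \<one> x") auto

lemma inv_eq_self: "x \<in> carrier G \<Longrightarrow> inv x = x"
  by (simp add: inv_equality square_one)

lemma perp_subset: "perp H \<subseteq> carrier G"
  by (auto simp: perp_def)

lemma perp_antimono: "H \<subseteq> K \<Longrightarrow> perp K \<subseteq> perp H"
  by (auto simp: perp_def)

text \<open>Orthogonality of characters: if \<open>f a = 1\<close> for some \<open>a\<close> in
  \<open>H\<close>, translation by \<open>a\<close> permutes \<open>H\<close> and negates every
  term, so the sum equals its own negative.\<close>

lemma sum_sign_hom:
  assumes H: "subgroup H G"
    and hom: "\<And>x y. \<lbrakk>x \<in> H; y \<in> H\<rbrakk> \<Longrightarrow> f (x \<otimes> y) = f x + f y"
  shows "(\<Sum>x\<in>H. sign (f x)) = (if \<forall>x\<in>H. f x = 0 then int (card H) else 0)"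
proof (cases "\<forall>x\<in>H. f x = 0")
  case True
  then show ?thesis by (simp add: sign_def)
next
  case False
  then obtain a where a: "a \<in> H" "f a = 1" by auto
  have HG: "H \<subseteq> carrier G" using H by (rule subgroup.subset)
  have "bij_betw ((\<otimes>) a) H H"
    by (rule bij_betwI[where g = "(\<otimes>) a"])
      (use a HG subgroup.m_closed[OF H] in \<open>auto simp: subset_iff square_one m_assoc[symmetric]\<close>)
  then have "(\<Sum>x\<in>H. sign (f x)) = (\<Sum>x\<in>H. sign (f (a \<otimes> x)))"
    by (rule sum.reindex_bij_betw[symmetric])
  also have "\<dots> = - (\<Sum>x\<in>H. sign (f x))"
    unfolding sum_negf[symmetric]
    by (rule sum.cong) (simp_all add: hom a sign_add, simp add: sign_def)
  finally show ?thesis using False by auto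
qed

text \<open>Evaluate the character sum of \<open>(-1)\<^sup>b\<^sup>(\<^sup>x\<^sup>,\<^sup>h\<^sup>)\<close> over \<open>x\<close> in the whole group and
  \<open>h\<close> in \<open>H\<close> in both orders.\<close>

lemma card_mult_card_perp:
  assumes H: "subgroup H G"
  shows "card H * card (perp H) = card (carrier G)"
proof -
  have HG: "H \<subseteq> carrier G" using H by (rule subgroup.subset)
  have one: "\<one> \<in> H" using H by (rule subgroup.one_closed)
  have fin: "finite H" using HG finite_carrier finite_subset by blast
  have "int (card H * card (perp H)) = (\<Sum>x\<in>perp H. int (card H))"
    by simp
  also have "\<dots> = (\<Sum>x\<in>carrier G. if \<forall>h\<in>H. b x h = 0 then int (card H) else 0)"
    unfolding perp_def by (rule sum.inter_filter[OF finite_carrier])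
  also have "\<dots> = (\<Sum>x\<in>carrier G. \<Sum>h\<in>H. sign (b x h))"
  proof (rule sum.cong[OF refl])
    fix x assume "x \<in> carrier G"
    then show "(if \<forall>h\<in>H. b x h = 0 then int (card H) else 0) = (\<Sum>h\<in>H. sign (b x h))"
      using HG by (subst sum_sign_hom[OF H]) (auto simp: form_mult_right subset_iff)
  qed
  also have "\<dots> = (\<Sum>h\<in>H. \<Sum>x\<in>carrier G. sign (b x h))"
    by (rule sum.swap)
  also have "\<dots> = (\<Sum>h\<in>H. if h = \<one> then int (card (carrier G)) else 0)"
  proof (rule sum.cong[OF refl])
    fix h assume "h \<in> H"
    then have h: "h \<in> carrier G" using HG by blast
    \<comment> \<open>Nondegeneracy enters here: only \<open>h = \<one>\<close> gives the trivial
      character of the whole group, so all other inner sums vanish.\<close>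
    have "(\<forall>x\<in>carrier G. b x h = 0) \<longleftrightarrow> h = \<one>"
      using nondegenerate[OF h] form_one_left form_commute h by (metis one_closed)
    then show "(\<Sum>x\<in>carrier G. sign (b x h)) = (if h = \<one> then int (card (carrier G)) else 0)"
      using h by (subst sum_sign_hom[OF subgroup_self]) (auto simp: form_mult)
  qed
  also have "\<dots> = int (card (carrier G))"
    using fin one by simp
  finally show ?thesis by (simp only: of_nat_eq_iff)
qed

section \<open>Independent lists and their spans\<close>

fun list_span :: "'a list \<Rightarrow> 'a set" where
  "list_span [] = {\<one>}"
| "list_span (y # ys) = list_span ys \<union> (\<otimes>) y ` list_span ys"

text \<open>The parameter \<open>A\<close> maps the span reached so far to the permitted next
  entries. With \<open>A = perp\<close> these lists are ordered bases of isotropic subgroups, with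
  constant \<open>A = C\<close> independent lists inside \<open>C\<close>, so one definition serves
  both counts.\<close>

fun indep_lists :: "('a set \<Rightarrow> 'a set) \<Rightarrow> nat \<Rightarrow> 'a list set" where
  "indep_lists A 0 = {[]}"
| "indep_lists A (Suc k) =
    (\<lambda>(ys, y). y # ys) ` (SIGMA ys:indep_lists A k. A (list_span ys) - list_span ys)"

text \<open>The number of choices for the next entry depends on the length of the list alone, so the
  choices multiply.\<close>

lemma card_indep_lists:
  assumes "\<And>H. A H \<subseteq> carrier G"
    and "\<And>j ys. \<lbrakk>j < k; ys \<in> indep_lists A j\<rbrakk> \<Longrightarrow> card (A (list_span ys) - list_span ys) = e j"
  shows "finite (indep_lists A k) \<and> card (indep_lists A k) = (\<Prod>j<k. e j)"
  using assms(2)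
proof (induction k)
  case 0
  then show ?case by simp
next
  case (Suc k)
  have inj: "inj_on (\<lambda>(ys, y). y # ys) S" for S :: "('a list \<times> 'a) set"
    by (auto simp: inj_on_def)
  have fin: "finite (A H - K)" for H K
    using assms(1) finite_carrier by (meson finite_Diff finite_subset)
  have IH: "finite (indep_lists A k)" "card (indep_lists A k) = (\<Prod>j<k. e j)"
    using Suc.IH Suc.prems by auto
  show ?case
    using IH fin Suc.prems[of k] by (simp add: card_image[OF inj] mult.commute)
qed

text \<open>One coset suffices: since \<open>y\<close> squares to one, the product of two elements
  of that coset falls back into \<open>H\<close>.\<close>

lemma subgroup_adjoin:
  assumes H: "subgroup H G" and y: "y \<in> carrier G"
  shows "subgroup (H \<union> (\<otimes>) y ` H) G"
proof (rule subgroupI)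
  have HG: "H \<subseteq> carrier G" using H by (rule subgroup.subset)
  then show sub: "H \<union> (\<otimes>) y ` H \<subseteq> carrier G" using y by auto
  show "H \<union> (\<otimes>) y ` H \<noteq> {}" using subgroup.one_closed[OF H] by auto
  show "inv a \<in> H \<union> (\<otimes>) y ` H" if "a \<in> H \<union> (\<otimes>) y ` H" for a
    using that sub inv_eq_self by (metis subsetD)
  have mc: "h \<otimes> k \<in> H" if "h \<in> H" "k \<in> H" for h k
    using that by (rule subgroup.m_closed[OF H])
  have 1: "h \<otimes> (y \<otimes> k) = y \<otimes> (h \<otimes> k)" if "h \<in> H" "k \<in> H" for h k
    using that HG y by (simp add: m_lcomm subset_iff)
  have 2: "(y \<otimes> h) \<otimes> k = y \<otimes> (h \<otimes> k)" if "h \<in> H" "k \<in> H" for h k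
    using that HG y by (simp add: m_assoc subset_iff)
  have 3: "y \<otimes> (y \<otimes> k) = k" if "k \<in> H" for k
    using that HG y by (simp add: m_assoc[symmetric] square_one subset_iff)
  show "c \<otimes> d \<in> H \<union> (\<otimes>) y ` H" if "c \<in> H \<union> (\<otimes>) y ` H" "d \<in> H \<union> (\<otimes>) y ` H" for c d
  proof -
    have "y \<otimes> h \<otimes> (y \<otimes> k) = h \<otimes> k" if "h \<in> H" "k \<in> H" for h k
      using that HG y by (metis 1 3 m_assoc m_closed mc subsetD)
    then show ?thesis using that mc by (auto simp: 1 2)
  qed
qed

lemma card_adjoin:
  assumes H: "subgroup H G" and y: "y \<in> carrier G" "y \<notin> H"
  shows "card (H \<union> (\<otimes>) y ` H) = 2 * card H"
proof -
  have HG: "H \<subseteq> carrier G" using H by (rule subgroup.subset)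
  have fin: "finite H" using HG finite_carrier finite_subset by blast
  have "inj_on ((\<otimes>) y) H"
    using inj_on_cmult[OF y(1)] HG inj_on_subset by blast
  moreover have "H \<inter> (\<otimes>) y ` H = {}"
  proof -
    have False if "h \<in> H" "y \<otimes> h \<in> H" for h
    proof -
      \<comment> \<open>\<open>h\<close> is its own inverse, so a common element of \<open>H\<close>
        and the coset would put \<open>y\<close> into \<open>H\<close>.\<close>
      have "y = (y \<otimes> h) \<otimes> h"
        using that HG y by (auto simp: m_assoc square_one)
      then show False using that subgroup.m_closed[OF H] y(2) by metis
    qed
    then show ?thesis by auto
  qed
  ultimately show ?thesis
    using fin by (simp add: card_Un_disjoint card_image)
qed

lemma indep_list_span:
  assumes "\<And>H. A H \<subseteq> carrier G"
  shows "ys \<in> indep_lists A k \<Longrightarrow> subgroup (list_span ys) G \<and> card (list_span ys) = 2 ^ k"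
proof (induction k arbitrary: ys)
  case 0
  then show ?case by (simp add: triv_subgroup)
next
  case (Suc k)
  then obtain z zs where "ys = z # zs" "zs \<in> indep_lists A k" "z \<in> A (list_span zs)" "z \<notin> list_span zs"
    by auto
  then show ?case
    using Suc.IH[of zs] assms subgroup_adjoin card_adjoin by (auto simp: subset_iff)
qed

text \<open>Each new entry is orthogonal to the earlier span by choice and to itself because the
  form is alternating; additivity extends this to the enlarged span.\<close>

lemma indep_list_isotropic:
  "ys \<in> indep_lists perp k \<Longrightarrow> list_span ys \<subseteq> perp (list_span ys)"
proof (induction k arbitrary: ys)
  case 0
  then show ?case by (simp add: perp_def form_self)
next
  case (Suc k)
  then obtain z zs where ys: "ys = z # zs" "zs \<in> indep_lists perp k" and z: "z \<in> perp (list_span zs)"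
    by auto
  let ?H = "list_span zs"
  have HG: "?H \<subseteq> carrier G"
    using indep_list_span[OF perp_subset ys(2)] subgroup.subset by blast
  have iso: "b h k = 0" if "h \<in> ?H" "k \<in> ?H" for h k
    using Suc.IH[OF ys(2)] that by (auto simp: perp_def)
  have zH: "b z h = 0" if "h \<in> ?H" for h
    using z that by (auto simp: perp_def)
  have zG: "z \<in> carrier G" using z by (auto simp: perp_def)
  have Hz: "b h z = 0" if "h \<in> ?H" for h
    using zH[OF that] HG that zG form_commute by auto
  show ?case
    using HG zG
    by (auto simp: ys perp_def form_mult form_mult_right iso zH Hz form_self subset_iff)
qed

section \<open>Counting Lagrangian subgroups\<close>

lemma card_lagrangian:
  assumes V: "card (carrier G) = 4 ^ n" and C: "C \<in> lagrangians"
  shows "card C = 2 ^ n"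
proof -
  have "card C * card C = (2 ^ n) * (2 ^ n)"
    using card_mult_card_perp[of C] C V
    by (simp add: lagrangians_def power_mult_distrib[symmetric])
  then show ?thesis by (simp add: power2_eq_square[symmetric])
qed

text \<open>The complement of a subgroup of order 2^n also has order 2^n, so the inclusion is an
  equality of finite sets.\<close>

lemma isotropic_imp_lagrangian:
  assumes V: "card (carrier G) = 4 ^ n" and H: "subgroup H G" "card H = 2 ^ n" "H \<subseteq> perp H"
  shows "H \<in> lagrangians"
proof -
  have "2 ^ n * card (perp H) = 2 ^ n * 2 ^ n"
    using card_mult_card_perp[OF H(1)] V H(2) by (simp add: power_mult_distrib[symmetric])
  then have "H = perp H"
    using H finite_subset[OF perp_subset finite_carrier] by (intro card_subset_eq) auto
  then show ?thesis using H by (simp add: lagrangians_def)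
qed

text \<open>Links the two kinds of lists. As \<open>C = perp C\<close>, an element of
  \<open>C\<close> is automatically orthogonal to any span contained in \<open>C\<close>.\<close>

lemma indep_lists_in_lagrangian:
  assumes C: "C \<in> lagrangians"
  shows "ys \<in> indep_lists (\<lambda>_. C) k \<longleftrightarrow> ys \<in> indep_lists perp k \<and> list_span ys \<subseteq> C"
proof (induction k arbitrary: ys)
  case 0
  then show ?case using C by (auto simp: lagrangians_def subgroup.one_closed)
next
  case (Suc k)
  have sub: "subgroup C G" and CC: "C = perp C"
    using C by (auto simp: lagrangians_def)
  show ?case
  proof (cases ys)
    case Nil
    then show ?thesis by auto
  next
    case (Cons z zs)
    have "z \<in> C" if "zs \<in> indep_lists perp k" "z \<in> perp (list_span zs)" "(\<otimes>) z ` list_span zs \<subseteq> C"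
    proof -
      have "\<one> \<in> list_span zs"
        using indep_list_span[OF perp_subset that(1)] subgroup.one_closed by blast
      \<comment> \<open>The coset contains \<open>z\<close> itself, as the product of
        \<open>z\<close> with \<open>\<one>\<close>.\<close>
      moreover have "z \<in> carrier G" using that(2) by (simp add: perp_def)
      ultimately show ?thesis using that(3) r_one by (metis image_eqI subsetD)
    qed
    moreover have "z \<in> perp (list_span zs)" if "z \<in> C" "list_span zs \<subseteq> C"
      using that perp_antimono CC by blast
    ultimately show ?thesis
      using Suc.IH[of zs] subgroup.m_closed[OF sub] by (auto simp: Cons)
  qed
qed

text \<open>Ordered bases of Lagrangian subgroups are counted twice: a sequence of \<open>j\<close> independent,
  mutually orthogonal vectors with span \<open>H\<close> extends by any of the \<open>2\<^sup>2\<^sup>n\<^sup>-\<^sup>j - 2\<^sup>j\<close> elements of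
  \<open>perp H - H\<close>, and within a given Lagrangian subgroup by any of \<open>2\<^sup>n - 2\<^sup>j\<close> elements.\<close>

theorem card_lagrangians:
  assumes V: "card (carrier G) = 4 ^ n"
  shows "card lagrangians = (\<Prod>i=1..n. 2 ^ i + 1)"
proof -
  \<comment> \<open>The factorisation 2^(2n-j) - 2^j = (2^n - 2^j)(2^(n-j) + 1) isolates the number
    of choices inside a single Lagrangian subgroup, which cancels at the end.\<close>
  have card_iso: "finite (indep_lists perp n) \<and>
      card (indep_lists perp n) = (\<Prod>j<n. (2 ^ n - 2 ^ j) * (2 ^ (n - j) + 1))"
  proof (rule card_indep_lists[OF perp_subset])
    fix j ys assume j: "j < n" and ys: "ys \<in> indep_lists perp j"
    let ?H = "list_span ys"
    have H: "subgroup ?H G" "card ?H = 2 ^ j"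
      using indep_list_span[OF perp_subset ys] by auto
    have n: "(2::nat) ^ n = 2 ^ j * 2 ^ (n - j)"
      using j by (simp flip: power_add)
    have "2 ^ j * card (perp ?H) = 2 ^ j * (2 ^ n * 2 ^ (n - j))"
      using card_mult_card_perp[OF H(1)] V H(2)
      by (simp add: mult.left_commute[of "2 ^ j"] n[symmetric] power_mult_distrib[symmetric])
    then have "card (perp ?H) = 2 ^ n * 2 ^ (n - j)" by simp
    moreover have "card (perp ?H - ?H) = card (perp ?H) - card ?H"
      using indep_list_isotropic[OF ys] finite_subset[OF perp_subset finite_carrier]
      by (meson card_Diff_subset finite_subset)
    ultimately show "card (perp ?H - ?H) = (2 ^ n - 2 ^ j) * (2 ^ (n - j) + 1)"
      using H(2) by (simp add: diff_mult_distrib n algebra_simps)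
  qed
  have card_in: "card (indep_lists (\<lambda>_. C) n) = (\<Prod>j<n. 2 ^ n - 2 ^ j)" if C: "C \<in> lagrangians" for C
  proof (rule conjunct2[OF card_indep_lists])
    show CG: "C \<subseteq> carrier G" using C by (auto simp: lagrangians_def dest: subgroup.subset)
    fix j ys assume ys: "ys \<in> indep_lists (\<lambda>_. C) j"
    have "list_span ys \<subseteq> C" using indep_lists_in_lagrangian[OF C] ys by blast
    moreover have "finite C" using CG finite_carrier finite_subset by blast
    ultimately show "card (C - list_span ys) = 2 ^ n - 2 ^ j"
      using indep_list_span[OF CG ys] card_lagrangian[OF V C]
      by (metis card_Diff_subset finite_subset)
  qed
  \<comment> \<open>A span of order 2^n contained in \<open>C\<close> is all of \<open>C\<close>, so
    the fibre of \<open>list_span\<close> over \<open>C\<close> consists of the ordered bases of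
    \<open>C\<close>.\<close>
  have fib: "{ys \<in> indep_lists perp n. list_span ys = C} = indep_lists (\<lambda>_. C) n"
    if C: "C \<in> lagrangians" for C
  proof -
    have "finite C"
      using C finite_carrier by (auto simp: lagrangians_def dest: subgroup.subset finite_subset)
    then have "list_span ys = C" if "ys \<in> indep_lists perp n" "list_span ys \<subseteq> C" for ys
      using that indep_list_span[OF perp_subset that(1)] card_lagrangian[OF V C]
      by (metis card_subset_eq)
    then show ?thesis using indep_lists_in_lagrangian[OF C] by blast
  qed
  have finL: "finite lagrangians"
    by (rule finite_subset[of _ "Pow (carrier G)"])
      (auto simp: finite_carrier lagrangians_def dest: subgroup.mem_carrier)
  have img: "list_span ` indep_lists perp n \<subseteq> lagrangians"
    using indep_list_span[of perp, OF perp_subset] indep_list_isotropic isotropic_imp_lagrangian[OF V] by blast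
  have "card (indep_lists perp n) =
      (\<Sum>C\<in>lagrangians. card {ys \<in> indep_lists perp n. list_span ys = C})"
    using sum.group[OF conjunct1[OF card_iso] finL img, of "\<lambda>_. 1::nat"] by simp
  also have "\<dots> = card lagrangians * (\<Prod>j<n. 2 ^ n - 2 ^ j)"
    by (simp add: fib card_in)
  finally have eq: "card lagrangians * (\<Prod>j<n. 2 ^ n - 2 ^ j)
      = (\<Prod>j<n. 2 ^ (n - j) + 1) * (\<Prod>j<n. 2 ^ n - 2 ^ j)"
    by (simp only: conjunct2[OF card_iso] prod.distrib mult.commute)
  \<comment> \<open>Every factor has \<open>j < n\<close>, so the truncated difference is positive
    and the product may be cancelled.\<close>
  have "(\<Prod>j<n. 2 ^ n - 2 ^ j) \<noteq> (0::nat)"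
    by (simp add: not_le)
  then have "card lagrangians = (\<Prod>j<n. 2 ^ (n - j) + 1)"
    using eq by (rule mult_right_cancel[THEN iffD1])
  also have "\<dots> = (\<Prod>i=1..n. 2 ^ i + 1)"
    by (rule prod.reindex_bij_witness[where i = "\<lambda>i. n - i" and j = "\<lambda>j. n - j"]) auto
  finally show ?thesis .
qed

end

section \<open>Codes over the Klein four-group\<close>

lemma klein_add_commute: "klein_add x y = klein_add y x"
  by (cases x; cases y) simp_all

lemma dot_add: "dot (klein_add x y) z = dot x z + dot y z"
  by (cases x; cases y; cases z) (simp_all add: dot_def q_def klein_group_def)

lemma dot_commute: "dot x y = dot y x"
  by (cases x; cases y) (simp_all add: dot_def q_def klein_group_def)

lemma dot_self: "dot x x = 0"
  by (cases x) (simp_all add: dot_def q_def klein_group_def)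

lemma dot_K0: "dot x K0 = 0"
  by (cases x) (simp_all add: dot_def q_def klein_group_def)

lemma UNIV_klein: "UNIV = {K0, K1, Kw, Kwbar}"
  using klein.exhaust by auto

lemma carrier_Ln: "carrier (Ln n) = {1..n} \<rightarrow>\<^sub>E UNIV"
  by (simp add: Ln_def klein_group_def)

lemma mult_Ln: "x \<otimes>\<^bsub>Ln n\<^esub> y = (\<lambda>i\<in>{1..n}. klein_add (x i) (y i))"
  by (simp add: Ln_def klein_group_def)

lemma one_Ln: "\<one>\<^bsub>Ln n\<^esub> = (\<lambda>i\<in>{1..n}. K0)"
  by (simp add: Ln_def klein_group_def)

lemma group_Ln: "group (Ln n)"
  by (simp add: Ln_def group_klein_group)

lemma finite_carrier_Ln: "finite (carrier (Ln n))"
  by (simp add: carrier_Ln UNIV_klein finite_PiE)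

lemma card_carrier_Ln: "card (carrier (Ln n)) = 4 ^ n"
  by (simp add: carrier_Ln card_PiE UNIV_klein numeral_eq_Suc)

text \<open>A test vector supported on a single coordinate isolates one term of the scalar
  product.\<close>

lemma scalar_prod_nondegenerate:
  assumes x: "x \<in> carrier (Ln n)"
    and orth: "\<And>y. y \<in> carrier (Ln n) \<Longrightarrow> scalar_prod n x y = 0"
  shows "x = \<one>\<^bsub>Ln n\<^esub>"
proof -
  have "x i = K0" if i: "i \<in> {1..n}" for i
  proof (rule ccontr)
    assume "x i \<noteq> K0"
    \<comment> \<open>Any nonzero element other than \<open>x i\<close> serves as
      \<open>u\<close>.\<close>
    then obtain u where u: "dot (x i) u = 1"
      unfolding dot_eq_1_iff by (metis klein.distinct(1,3,7))
    let ?y = "\<lambda>j\<in>{1..n}. if j = i then u else K0"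
    have "scalar_prod n x ?y = (\<Sum>j=1..n. if j = i then dot (x i) u else 0)"
      unfolding scalar_prod_def by (rule sum.cong) (auto simp: dot_K0)
    also have "\<dots> = 1" using i u by simp
    finally show False using orth[of ?y] by (simp add: carrier_Ln)
  qed
  then show ?thesis
    using x by (auto simp: one_Ln carrier_Ln PiE_def extensional_def fun_eq_iff)
qed

text \<open>The Klein group with \<open>dot\<close> is the symplectic plane over F_2; here the
  orthogonal sum of \<open>n\<close> copies enters the locale.\<close>

lemma binary_symplectic_Ln: "binary_symplectic (Ln n) (scalar_prod n)"
proof -
  interpret group "Ln n" by (rule group_Ln)
  interpret comm_group "Ln n"
    by (rule group_comm_groupI) (auto simp: mult_Ln klein_add_commute)
  show ?thesis
  proof
    show "x = \<one>\<^bsub>Ln n\<^esub>" if "x \<in> carrier (Ln n)" "\<And>y. y \<in> carrier (Ln n) \<Longrightarrow> scalar_prod n x y = 0" for x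
      using that by (rule scalar_prod_nondegenerate)
    show "scalar_prod n x y = scalar_prod n y x" for x y
      by (simp only: scalar_prod_def dot_commute)
    show "scalar_prod n (x \<otimes>\<^bsub>Ln n\<^esub> y) z = scalar_prod n x z + scalar_prod n y z" for x y z
      unfolding scalar_prod_def sum.distrib[symmetric]
      by (rule sum.cong) (simp_all only: mult_Ln restrict_apply if_True dot_add)
  qed (auto simp: finite_carrier_Ln mult_Ln one_Ln klein_add_self scalar_prod_def dot_self
      intro!: restrict_ext)
qed

theorem card_self_dual_codes: "card (self_dual_codes n) = (\<Prod>i=1..n. 2 ^ i + 1)"
proof -
  interpret binary_symplectic "Ln n" "scalar_prod n" by (rule binary_symplectic_Ln)
  have "self_dual_codes n = lagrangians"
    by (simp add: self_dual_codes_def lagrangians_def L_code_def dual_code_def perp_def)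
  then show ?thesis using card_lagrangians[OF card_carrier_Ln] by simp
qed

lemma finite_self_dual_codes: "finite (self_dual_codes n)"
  by (rule finite_subset[of _ "Pow (carrier (Ln n))"])
    (auto simp: finite_carrier_Ln self_dual_codes_def L_code_def dest: subgroup.mem_carrier)

section \<open>The action on self-dual codes\<close>

lemma klein_swap_add: "klein_swap (klein_add x y) = klein_add (klein_swap x) (klein_swap y)"
  by (cases x; cases y) simp_all

lemma dot_klein_swap: "dot (klein_swap x) (klein_swap y) = dot x y"
  by (cases x; cases y) (simp_all add: dot_def q_def klein_group_def)

lemma vec_act_hom:
  assumes g: "g \<in> carrier (code_group n)"
  shows "vec_act n g (x \<otimes>\<^bsub>Ln n\<^esub> y) = vec_act n g x \<otimes>\<^bsub>Ln n\<^esub> vec_act n g y"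
proof -
  obtain s p where sp: "g = (s, p)" by fastforce
  then have s: "s \<in> {1..n} \<rightarrow>\<^sub>E {id, klein_swap}" and p: "p permutes {1..n}"
    using g by (auto simp: code_group_def sym_group_def swap_group_def)
  have "s i (klein_add u v) = klein_add (s i u) (s i v)" if "i \<in> {1..n}" for i u v
    using PiE_mem[OF s that] by (auto simp: klein_swap_add)
  then show ?thesis
    using inv_in_range[OF p] by (auto simp: sp vec_act_def mult_Ln intro!: restrict_ext)
qed

text \<open>Swaps preserve \<open>dot\<close> in each coordinate, and the permutation merely
  reorders the summands.\<close>

lemma scalar_prod_vec_act:
  assumes g: "g \<in> carrier (code_group n)"
  shows "scalar_prod n (vec_act n g x) (vec_act n g y) = scalar_prod n x y"
proof -
  obtain s p where sp: "g = (s, p)" by fastforce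
  then have s: "s \<in> {1..n} \<rightarrow>\<^sub>E {id, klein_swap}" and p: "p permutes {1..n}"
    using g by (auto simp: code_group_def sym_group_def swap_group_def)
  have dot: "dot (s i u) (s i v) = dot u v" if "i \<in> {1..n}" for i u v
    using PiE_mem[OF s that] by (auto simp: dot_klein_swap)
  have "scalar_prod n (vec_act n g x) (vec_act n g y)
      = (\<Sum>i=1..n. dot (x (inv' p i)) (y (inv' p i)))"
    unfolding scalar_prod_def sp vec_act_def by (rule sum.cong) (simp_all add: dot)
  also have "\<dots> = scalar_prod n x y"
    unfolding scalar_prod_def
    by (rule sum.reindex_bij_betw[OF permutes_imp_bij[OF permutes_inv[OF p]]])
  finally show ?thesis .
qed

lemma code_act_one:
  assumes "C \<subseteq> carrier (Ln n)"
  shows "code_act n \<one>\<^bsub>code_group n\<^esub> C = C"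
  using assms by (force simp: code_act_def vec_act_one subset_iff)

lemma code_act_mult:
  assumes "g \<in> carrier (code_group n)" "h \<in> carrier (code_group n)"
  shows "code_act n (g \<otimes>\<^bsub>code_group n\<^esub> h) C = code_act n g (code_act n h C)"
  by (simp add: code_act_def vec_act_mult[OF assms] image_image)

text \<open>Group elements act as isometric homomorphisms, so images of codes are codes and
  orthogonality is preserved.\<close>

lemma code_act_self_dual:
  assumes g: "g \<in> carrier (code_group n)" and C: "C \<in> self_dual_codes n"
  shows "code_act n g C \<in> self_dual_codes n"
proof -
  interpret K: group "code_group n" by (rule group_code_group)
  interpret L: group "Ln n" by (rule group_Ln)
  have sub: "subgroup C (Ln n)" and CC: "C = dual_code n C"
    using C by (auto simp: self_dual_codes_def L_code_def)
  have orth: "scalar_prod n x y = 0" if "x \<in> C" "y \<in> C" for x y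
    using that CC by (auto simp: dual_code_def)
  interpret f: group_hom "Ln n" "Ln n" "vec_act n g"
    by unfold_locales (auto simp: hom_def vec_act_closed vec_act_hom[OF g])
  have "subgroup (code_act n g C) (Ln n)"
    unfolding code_act_def using sub by (rule f.subgroup_img_is_subgroup)
  moreover have "code_act n g C = dual_code n (code_act n g C)"
  proof
    show "code_act n g C \<subseteq> dual_code n (code_act n g C)"
      by (auto simp: code_act_def dual_code_def vec_act_closed scalar_prod_vec_act[OF g] orth)
    show "dual_code n (code_act n g C) \<subseteq> code_act n g C"
    proof
      fix x assume x: "x \<in> dual_code n (code_act n g C)"
      \<comment> \<open>A vector orthogonal to the image is pulled back by the inverse; the result
        is orthogonal to \<open>C\<close>, hence in \<open>C\<close> by self-duality.\<close>
      let ?h = "inv\<^bsub>code_group n\<^esub> g"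
      have xL: "x \<in> carrier (Ln n)" using x by (simp add: dual_code_def)
      have act_back: "vec_act n g (vec_act n ?h x) = x"
        using g xL by (simp flip: vec_act_mult add: vec_act_one)
      have "scalar_prod n (vec_act n ?h x) y = 0" if "y \<in> C" for y
        using x that scalar_prod_vec_act[OF g, of "vec_act n ?h x" y]
        by (simp add: act_back dual_code_def code_act_def)
      then have "vec_act n ?h x \<in> C"
        by (subst CC) (simp add: dual_code_def vec_act_closed)
      then show "x \<in> code_act n g C"
        unfolding code_act_def using act_back by (metis imageI)
    qed
  qed
  ultimately show ?thesis by (simp add: self_dual_codes_def L_code_def)
qed

text \<open>The library's group actions are homomorphisms into groups of extensional bijections,
  hence the restriction.\<close>

lemma group_action_self_dual_codes:
  "group_action (code_group n) (self_dual_codes n) (\<lambda>g. restrict (code_act n g) (self_dual_codes n))"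
proof -
  let ?E = "self_dual_codes n"
  interpret K: group "code_group n" by (rule group_code_group)
  have EL: "C \<subseteq> carrier (Ln n)" if "C \<in> ?E" for C
    using that by (auto simp: self_dual_codes_def L_code_def dest: subgroup.mem_carrier)
  have bij: "restrict (code_act n g) ?E \<in> Bij ?E" if g: "g \<in> carrier (code_group n)" for g
  proof -
    have "bij_betw (code_act n g) ?E ?E"
      by (rule bij_betwI[where g = "code_act n (inv\<^bsub>code_group n\<^esub> g)"])
        (use g EL in \<open>auto simp: code_act_self_dual code_act_one simp flip: code_act_mult\<close>)
    then show ?thesis by (simp add: Bij_def)
  qed
  show ?thesis
    unfolding group_action_def group_hom_def group_hom_axioms_def
    by (intro conjI K.is_group group_BijGroup)
      (auto simp: hom_def bij BijGroup_def code_act_mult compose_def code_act_self_dual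
        intro!: restrict_ext)
qed

text \<open>By orbit-stabilizer each summand is the size of its class. A class is a set of codes, so
  \<open>rep\<close> picks the code whose automorphism group is taken, and the choice is
  arbitrary.\<close>

theorem theorem4p9:
  fixes n :: nat and rep :: "(nat \<Rightarrow> klein) set set \<Rightarrow> (nat \<Rightarrow> klein) set"
  assumes "n \<ge> 1"
    and "\<And>K. K \<in> self_dual_classes n \<Longrightarrow> rep K \<in> K"
  shows "real (card (self_dual_codes n)) =
           (\<Sum>K\<in>self_dual_classes n. real (2 ^ n * fact n) / real (card (Aut n (rep K))))
       \<and> (\<Sum>K\<in>self_dual_classes n. real (2 ^ n * fact n) / real (card (Aut n (rep K)))) =
           (\<Prod>i=1..n. 2 ^ i + 1 :: real)"
proof -
  let ?G = "code_group n" and ?E = "self_dual_codes n"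
  let ?\<phi> = "\<lambda>g. restrict (code_act n g) ?E"
  interpret act: group_action ?G ?E ?\<phi> by (rule group_action_self_dual_codes)
  \<comment> \<open>Restricting the action to self-dual codes changes neither the orbit nor the
    stabilizer of such a code.\<close>
  have orbit: "orbit ?G ?\<phi> C = orbit ?G (code_act n) C"
    and stab: "stabilizer ?G ?\<phi> C = Aut n C" if "C \<in> ?E" for C
    using that by (auto simp: orbit_def stabilizer_def Aut_def)
  have classes: "self_dual_classes n = orbits ?G ?E ?\<phi>"
    unfolding self_dual_classes_def orbits_def using orbit by (metis (no_types, lifting))
  have summand: "real (2 ^ n * fact n) / real (card (Aut n (rep K))) = real (card K)"
    if K: "K \<in> self_dual_classes n" for K
  proof -
    obtain C where C: "C \<in> ?E" and KC: "K = orbit ?G ?\<phi> C"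
      using K unfolding classes orbits_def by blast
    have rE: "rep K \<in> ?E"
      using assms(2)[OF K] K act.orbits_coverture unfolding classes by blast
    then have "rep K \<in> orbit ?G ?\<phi> (rep K)" by (rule act.orbit_refl)
    \<comment> \<open>Two orbits sharing \<open>rep K\<close> coincide, so \<open>K\<close> is the
      orbit of its chosen representative.\<close>
    then have "K = orbit ?G ?\<phi> (rep K)"
      using act.disjoint_union[of K "orbit ?G ?\<phi> (rep K)"] assms(2)[OF K] K rE
      unfolding classes orbits_def by blast
    then have "card K * card (Aut n (rep K)) = 2 ^ n * fact n"
      using act.orbit_stabilizer_theorem[OF rE] by (simp add: stab[OF rE] order_code_group)
    then have eq: "real (card K) * real (card (Aut n (rep K))) = real (2 ^ n * fact n)"
      by (simp only: of_nat_mult[symmetric])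
    \<comment> \<open>The product in \<open>eq\<close> is positive; a nonzero denominator is needed
      because division by zero yields 0.\<close>
    then have "card (Aut n (rep K)) \<noteq> 0" by (intro notI) simp
    then show ?thesis by (simp only: eq[symmetric]) simp
  qed
  have "(\<Sum>K\<in>self_dual_classes n. real (2 ^ n * fact n) / real (card (Aut n (rep K))))
      = (\<Sum>K\<in>self_dual_classes n. \<Sum>C\<in>K. 1)"
    by (rule sum.cong) (simp_all only: summand sum_constant mult_1_right)
  \<comment> \<open>The classes partition the self-dual codes, so the double sum counts each code
    once.\<close>
  also have "\<dots> = real (card ?E)"
    unfolding classes by (simp only: act.disjoint_sum[OF finite_self_dual_codes]) simp
  finally have "(\<Sum>K\<in>self_dual_classes n. real (2 ^ n * fact n) / real (card (Aut n (rep K))))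
      = real (card ?E)" .
  moreover have "real (card ?E) = (\<Prod>i=1..n. 2 ^ i + 1)"
    by (simp add: card_self_dual_codes add.commute)
  ultimately show ?thesis by (simp only: simp_thms)
qed

end
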